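(* Let $\mathcal{S}=\{(i,j)\in\mathbb{Z}\times\mathbb{Z}\mid i\ge2j\}$. The underlying graded (quadratic) coalgebra of the bialgebra $\mathcal{B}$ over $\mathbb{F}_2$ is $(\mathbb{Z},\mathcal{S})$-admissible, with respect to the isomorphism $\mathbb{F}_2[\mathbb{Z}]\cong\mathcal{B}_1=\mathbb{F}_2[\alpha_1^{\pm1}]$, $[n]\mapsto\alpha_1^n$.
   Context: Bialgebra: for $n\in\mathbb{N}$, $\mathcal{B}_n=\mathbb{F}_2[\alpha_1,\ldots,\alpha_{n-1},\alpha_n^{\pm1}]$ (with $\alpha_0=1$, $\mathcal{B}_0=\mathbb{F}_2$), and the coproduct has components the algebra morphisms $\Delta_{i,j}:\mathcal{B}_{i+j}\to\mathcal{B}_i\otimes\mathcal{B}_j$, $\alpha_k\mapsto\sum_{s+t=k,\,0\le s\le i,\,0\le t\le j}\alpha_s^{2^t}\otimes\alpha_t$. In particular $\Delta_{1,1}:\mathcal{B}_2\to\mathcal{B}_1\otimes\mathcal{B}_1\cong\mathbb{F}_2[x^{\pm1},y^{\pm1}]$ (with $x=\alpha_1\otimes1$, $y=1\otimes\alpha_1$) sends $\alpha_1\mapsto x+y$, $\alpha_2\mapsto x^2y$; it is injective. The underlying coalgebra of $\mathcal{B}$ is quadratic: $\mathcal{B}\cong\langle\mathcal{B}_1;\Delta_{1,1}(\mathcal{B}_2)\rangle$, where $\langle V;R\rangle$ (for $R\le V^{\otimes2}$) denotes the subcoalgebra of the tensor coalgebra on $V$ given by $\mathbb{K}$ in degree $0$,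 $V$ in degree $1$, $\bigcap_{i+j+2=n}V^{\otimes i}\otimes R\otimes V^{\otimes j}$ in degree $n\geq2$. Admissibility: for a field $\mathbb{K}$, let $\mathbb{K}[\mathcal{I}]$ be the free $\mathbb{K}$-vector space on the set $\mathcal{I}$ with basis elements $[i]$. For $\mathcal{S}\subset\mathcal{I}\times\mathcal{I}$, a quadratic coalgebra $\langle V;R\rangle$ is $(\mathcal{I},\mathcal{S})$-admissible with respect to an isomorphism $\mathbb{K}[\mathcal{I}]\cong V$ if the composite $R\hookrightarrow V\otimes V\cong\mathbb{K}[\mathcal{I}\times\mathcal{I}]\twoheadrightarrow\mathbb{K}[\mathcal{S}]$ is an isomorphism, the last map sending $[w]\mapsto[w]$ for $w\in\mathcal{S}$ and $[w]\mapsto0$ for $w\notin\mathcal{S}$. *)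

theory Defs
  imports Complex_Main "HOL-Library.Poly_Mapping" "HOL-Library.Z2" "HOL-Library.Product_Plus"
begin

section \<open>Free vector spaces\<close>

text \<open>
  The free \<open>'k\<close>-vector space on a type \<open>'a\<close> is \<open>'a \<Rightarrow>\<^sub>0 'k\<close>, with basis element
  \<open>[a] = basis a\<close>.
\<close>

abbreviation lookup where "lookup \<equiv> Poly_Mapping.lookup"
abbreviation keys where "keys \<equiv> Poly_Mapping.keys"

definition scale :: "'k::field \<Rightarrow> ('a \<Rightarrow>\<^sub>0 'k) \<Rightarrow> ('a \<Rightarrow>\<^sub>0 'k)" where
  "scale c p = Poly_Mapping.map ((*) c) p"

lemma lookup_scale [simp]: "lookup (scale c p) a = c * lookup p a"
  by (simp add: scale_def Poly_Mapping.map.rep_eq when_def)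

interpretation free: vector_space "scale :: 'k::field \<Rightarrow> ('a \<Rightarrow>\<^sub>0 'k) \<Rightarrow> ('a \<Rightarrow>\<^sub>0 'k)"
  by standard (auto intro!: poly_mapping_eqI simp: lookup_add algebra_simps)

abbreviation basis :: "'a \<Rightarrow> ('a \<Rightarrow>\<^sub>0 'k::field)" where
  "basis a \<equiv> Poly_Mapping.single a 1"

text \<open>The linear map with \<open>[a] \<mapsto> f a\<close>.\<close>

definition lin_ext :: "('a \<Rightarrow> ('b \<Rightarrow>\<^sub>0 'k::field)) \<Rightarrow> ('a \<Rightarrow>\<^sub>0 'k) \<Rightarrow> ('b \<Rightarrow>\<^sub>0 'k)" where
  "lin_ext f p = (\<Sum>a\<in>keys p. scale (lookup p a) (f a))"

lemma lin_ext_superset: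
  assumes "finite A" "keys p \<subseteq> A"
  shows "lin_ext f p = (\<Sum>a\<in>A. scale (lookup p a) (f a))"
  unfolding lin_ext_def
  by (rule sum.mono_neutral_left) (use assms in \<open>auto simp: in_keys_iff\<close>)

lemma lin_ext_basis [simp]: "lin_ext f (basis a) = f a"
  by (simp add: lin_ext_def)

lemma linear_lin_ext:
  fixes f :: "'a \<Rightarrow> ('b \<Rightarrow>\<^sub>0 'k::field)"
  shows "Vector_Spaces.linear scale scale (lin_ext f)"
proof unfold_locales
  fix p q :: "'a \<Rightarrow>\<^sub>0 'k" and c :: 'k
  let ?A = "keys p \<union> keys q \<union> keys (p + q)"
  have "lin_ext f r = (\<Sum>a\<in>?A. scale (lookup r a) (f a))" if "keys r \<subseteq> ?A" for r
    using that by (intro lin_ext_superset) auto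
  then show "lin_ext f (p + q) = lin_ext f p + lin_ext f q"
    by (simp add: lookup_add free.scale_left_distrib sum.distrib subset_iff)
  have "keys (scale c p) \<subseteq> keys p"
    by (auto simp: in_keys_iff)
  then show "lin_ext f (scale c p) = scale c (lin_ext f p)"
    by (simp add: lin_ext_superset[of "keys p"] free.scale_sum_right)
qed

definition free_on :: "'a set \<Rightarrow> ('a \<Rightarrow>\<^sub>0 'k::field) set" where
  "free_on A = {p. keys p \<subseteq> A}"

definition proj_on :: "'a set \<Rightarrow> ('a \<Rightarrow>\<^sub>0 'k::field) \<Rightarrow> ('a \<Rightarrow>\<^sub>0 'k)" where
  "proj_on A = lin_ext (\<lambda>a. if a \<in> A then basis a else 0)"


section \<open>Tensor products\<close>

text \<open>
  The tensor product of the free spaces on \<open>'a\<close> and \<open>'b\<close> is the free space on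
  \<open>'a \<times> 'b\<close>. If \<open>'a\<close> and \<open>'b\<close> are commutative monoids, the two factors are monoid
  algebras, and the multiplication on \<open>('a \<times> 'b) \<Rightarrow>\<^sub>0 'k\<close> is that of the tensor product
  algebra. For subspaces \<open>V\<close> and \<open>W\<close>, \<open>V \<otimes> W\<close> is the span of the pure tensors; as we work
  over a field, the map from the abstract tensor product to this span is an isomorphism.
\<close>

definition tensor :: "('a \<Rightarrow>\<^sub>0 'k::field) \<Rightarrow> ('b \<Rightarrow>\<^sub>0 'k) \<Rightarrow> ('a \<times> 'b \<Rightarrow>\<^sub>0 'k)" where
  "tensor p q = lin_ext (\<lambda>a. lin_ext (\<lambda>b. basis (a, b)) q) p"

definition tensor_space :: "('a \<Rightarrow>\<^sub>0 'k::field) set \<Rightarrow> ('b \<Rightarrow>\<^sub>0 'k) set \<Rightarrow> ('a \<times> 'b \<Rightarrow>\<^sub>0 'k) set" where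
  "tensor_space V W = free.span {tensor v w | v w. v \<in> V \<and> w \<in> W}"

lemma lookup_lin_ext: "lookup (lin_ext f p) b = (\<Sum>a\<in>keys p. lookup p a * lookup (f a) b)"
  by (simp add: lin_ext_def lookup_sum)

lemma lookup_tensor: "lookup (tensor p q) (a, b) = lookup p a * lookup q b"
proof -
  have 1: "lookup (lin_ext (\<lambda>b'. basis (a', b')) q) (a, b) = (lookup q b when a' = a)" for a'
  proof -
    have "lookup (lin_ext (\<lambda>b'. basis (a', b')) q) (a, b)
        = (\<Sum>b'\<in>keys q. if b' = b then (lookup q b when a' = a) else 0)"
      unfolding lookup_lin_ext by (intro sum.cong) (auto simp: lookup_single when_def)
    then show ?thesis
      by (auto simp: in_keys_iff when_def)
  qed
  have "lookup (tensor p q) (a, b) = (\<Sum>a'\<in>keys p. lookup p a' * (lookup q b when a' = a))"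
    by (simp only: tensor_def lookup_lin_ext[of _ p] 1)
  also have "\<dots> = (\<Sum>a'\<in>keys p. if a' = a then lookup p a * lookup q b else 0)"
    by (intro sum.cong) (auto simp: when_def)
  finally have "lookup (tensor p q) (a, b)
      = (\<Sum>a'\<in>keys p. if a' = a then lookup p a * lookup q b else 0)" .
  then show ?thesis
    by (auto simp: in_keys_iff)
qed

text \<open>
  The tensor algebra of the free space on \<open>'a\<close> is the free space on words. The tensor
  product of homogeneous elements is given by concatenation of words, and \<open>word1\<close>, \<open>word2\<close>
  identify tensor degrees \<open>1\<close> and \<open>2\<close> with the spaces above.
\<close>

definition word1 :: "('a \<Rightarrow>\<^sub>0 'k::field) \<Rightarrow> ('a list \<Rightarrow>\<^sub>0 'k)" where
  "word1 = lin_ext (\<lambda>a. basis [a])"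

definition word2 :: "('a \<times> 'a \<Rightarrow>\<^sub>0 'k::field) \<Rightarrow> ('a list \<Rightarrow>\<^sub>0 'k)" where
  "word2 = lin_ext (\<lambda>(a, b). basis [a, b])"

definition conc :: "('a list \<Rightarrow>\<^sub>0 'k::field) \<Rightarrow> ('a list \<Rightarrow>\<^sub>0 'k) \<Rightarrow> ('a list \<Rightarrow>\<^sub>0 'k)" where
  "conc p q = lin_ext (\<lambda>u. lin_ext (\<lambda>v. basis (u @ v)) q) p"

definition conc_space :: "('a list \<Rightarrow>\<^sub>0 'k::field) set \<Rightarrow> ('a list \<Rightarrow>\<^sub>0 'k) set \<Rightarrow> ('a list \<Rightarrow>\<^sub>0 'k) set" where
  "conc_space V W = free.span {conc v w | v w. v \<in> V \<and> w \<in> W}"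

primrec tensor_power :: "('a \<Rightarrow>\<^sub>0 'k::field) set \<Rightarrow> nat \<Rightarrow> ('a list \<Rightarrow>\<^sub>0 'k) set" where
  "tensor_power V 0 = free.span {basis []}"
| "tensor_power V (Suc n) = conc_space (word1 ` V) (tensor_power V n)"


section \<open>Quadratic coalgebras and admissibility\<close>

text \<open>
  The subcoalgebra \<open>\<langle>V; R\<rangle>\<close> of the tensor coalgebra (with the deconcatenation coproduct),
  given by its homogeneous components.
\<close>

definition quadratic_coalgebra ::
    "('a \<Rightarrow>\<^sub>0 'k::field) set \<Rightarrow> ('a \<times> 'a \<Rightarrow>\<^sub>0 'k) set \<Rightarrow> nat \<Rightarrow> ('a list \<Rightarrow>\<^sub>0 'k) set" where
  "quadratic_coalgebra V R n =
    (if n = 0 then free.span {basis []}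
     else if n = 1 then word1 ` V
     else \<Inter>(i, j)\<in>{(i, j). i + j + 2 = n}.
       conc_space (tensor_power V i) (conc_space (word2 ` R) (tensor_power V j)))"

text \<open>The linear map \<open>\<K>[\<I> \<times> \<I>] \<rightarrow> V \<otimes> V\<close> induced by \<open>\<phi> : \<K>[\<I>] \<rightarrow> V\<close>.\<close>

definition tensor_square_map ::
    "(('i \<Rightarrow>\<^sub>0 'k::field) \<Rightarrow> ('a \<Rightarrow>\<^sub>0 'k)) \<Rightarrow> ('i \<times> 'i \<Rightarrow>\<^sub>0 'k) \<Rightarrow> ('a \<times> 'a \<Rightarrow>\<^sub>0 'k)" where
  "tensor_square_map \<phi> = lin_ext (\<lambda>(i, j). tensor (\<phi> (basis i)) (\<phi> (basis j)))"

text \<open>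
  The index set is the type \<open>'i\<close>. The spaces \<open>V\<close> and \<open>R\<close> are determined by \<open>C\<close>, being its
  components of degrees \<open>1\<close> and \<open>2\<close>. As \<open>\<phi>\<close> is an isomorphism onto \<open>V\<close>, \<open>tensor_square_map \<phi>\<close>
  is injective with image \<open>V \<otimes> V\<close>, so \<open>inv\<close> is its inverse there; the composite
  \<open>R \<hookrightarrow> V \<otimes> V \<cong> \<K>[\<I> \<times> \<I>] \<rightarrow> \<K>[\<S>]\<close> is linear, so it is an isomorphism iff it is bijective.
\<close>

definition admissible ::
    "('i \<times> 'i) set \<Rightarrow> (nat \<Rightarrow> ('a list \<Rightarrow>\<^sub>0 'k::field) set) \<Rightarrow> (('i \<Rightarrow>\<^sub>0 'k) \<Rightarrow> ('a \<Rightarrow>\<^sub>0 'k)) \<Rightarrow> bool" where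
  "admissible S C \<phi> \<longleftrightarrow>
    (\<exists>V R. free.subspace V \<and> free.subspace R \<and> R \<subseteq> tensor_space V V \<and>
       C = quadratic_coalgebra V R \<and>
       Vector_Spaces.linear scale scale \<phi> \<and> bij_betw \<phi> UNIV V \<and>
       bij_betw (proj_on S \<circ> inv (tensor_square_map \<phi>)) R (free_on S))"


section \<open>The bialgebra \<open>\<B>\<close>\<close>

text \<open>
  The monomial \<open>\<Prod>\<^sub>k \<alpha>\<^sub>k\<^bsup>m k\<^esup>\<close> (\<open>k \<ge> 1\<close>) is represented by its exponent function \<open>m\<close>, and all
  \<open>\<B>\<^sub>n\<close> are subalgebras of one Laurent polynomial algebra over \<open>\<F>\<^sub>2\<close>.
\<close>

type_synonym mon = "nat \<Rightarrow>\<^sub>0 int"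
type_synonym laurent = "mon \<Rightarrow>\<^sub>0 bit"

definition \<alpha> :: "nat \<Rightarrow> laurent" where
  "\<alpha> k = (if k = 0 then 1 else basis (Poly_Mapping.single k 1))"

definition \<B> :: "nat \<Rightarrow> laurent set" where
  "\<B> n = free_on {m. keys m \<subseteq> {1..n} \<and> (\<forall>k\<in>{1..<n}. lookup m k \<ge> 0)}"

text \<open>Integer powers in a commutative ring; a negative exponent is meaningful for units only.\<close>

definition int_power :: "'a::comm_ring_1 \<Rightarrow> int \<Rightarrow> 'a" where
  "int_power x n = (if n \<ge> 0 then x ^ nat n else (THE y. x * y = 1) ^ nat (- n))"

text \<open>
  \<open>\<Delta> i j\<close> is the algebra morphism \<open>\<B>\<^sub>i\<^sub>+\<^sub>j \<rightarrow> \<B>\<^sub>i \<otimes> \<B>\<^sub>j\<close> with \<open>\<alpha>\<^sub>k \<mapsto> \<Delta>_gen i j k\<close>, extended linearly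
  from its values on monomials. It is only meaningful on \<open>\<B> (i + j)\<close>; the image of \<open>\<alpha>\<^sub>i\<^sub>+\<^sub>j\<close> is the
  unit \<open>\<alpha>\<^sub>i\<^bsup>2^j\<^esup> \<otimes> \<alpha>\<^sub>j\<close>.
\<close>

definition \<Delta>_gen :: "nat \<Rightarrow> nat \<Rightarrow> nat \<Rightarrow> (mon \<times> mon \<Rightarrow>\<^sub>0 bit)" where
  "\<Delta>_gen i j k = (\<Sum>(s, t)\<in>{(s, t). s \<le> i \<and> t \<le> j \<and> s + t = k}. tensor (\<alpha> s ^ (2 ^ t)) (\<alpha> t))"

definition \<Delta> :: "nat \<Rightarrow> nat \<Rightarrow> laurent \<Rightarrow> (mon \<times> mon \<Rightarrow>\<^sub>0 bit)" where
  "\<Delta> i j = lin_ext (\<lambda>m. \<Prod>k\<in>keys m. int_power (\<Delta>_gen i j k) (lookup m k))"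

lemma tensor_basis: "tensor (basis a) (basis b) = basis (a, b)"
  by (simp add: tensor_def)

lemma tensor_one_one: "tensor (1 :: laurent) (1 :: laurent) = 1"
proof -
  have "tensor (basis 0 :: laurent) (basis 0 :: laurent) = basis (0, 0)"
    by (rule tensor_basis)
  then show ?thesis
    by (simp flip: zero_prod_def)
qed

lemma basis_power: "(basis a :: 'a::comm_monoid_add \<Rightarrow>\<^sub>0 bit) ^ n = basis (((+) a ^^ n) 0)"
  by (induction n) (simp_all add: mult_single)

lemma int_power_unit:
  fixes x y :: "'a::comm_ring_1"
  assumes "x * y = 1"
  shows "int_power x n = (if n \<ge> 0 then x ^ nat n else y ^ nat (- n))"
proof -
  have "z = y" if "x * z = 1" for z
  proof -
    have "z = (x * y) * z" by (simp add: assms)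
    also have "\<dots> = y * (x * z)" by (simp only: mult_ac)
    finally show ?thesis by (simp add: that)
  qed
  then have "(THE y. x * y = 1) = y"
    by (intro the_equality[of "\<lambda>y. x * y = 1", OF assms])
  then show ?thesis
    by (simp add: int_power_def)
qed

lemma int_power_add:
  fixes x :: "'a::comm_ring_1"
  assumes "x dvd 1 \<or> (a \<ge> 0 \<and> b \<ge> 0)"
  shows "int_power x (a + b) = int_power x a * int_power x b"
proof (cases "a \<ge> 0 \<and> b \<ge> 0")
  case True
  then show ?thesis
    by (simp add: int_power_def nat_add_distrib power_add)
next
  case False
  with assms obtain y where xy: "x * y = 1"
    by (metis dvdE)
  have *: "x ^ k * y ^ k = 1" for k
    by (simp add: xy flip: power_mult_distrib)
  have diff: "int_power x (int m - int n) = x ^ m * y ^ n" for m n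
  proof (cases "m \<ge> n")
    case True
    then obtain d where d: "m = n + d" by (auto simp: le_iff_add)
    have "x ^ (n + d) * y ^ n = x ^ d * (x ^ n * y ^ n)"
      by (simp only: power_add mult_ac)
    then show ?thesis
      by (simp add: int_power_unit[OF xy] d *)
  next
    case False
    then obtain d where d: "n = m + d" by (metis le_iff_add nat_le_linear)
    have "x ^ m * y ^ (m + d) = (x ^ m * y ^ m) * y ^ d"
      by (simp only: power_add mult_ac)
    then show ?thesis
      using False by (simp add: int_power_unit[OF xy] d *)
  qed
  obtain m n m' n' where ab: "a = int m - int n" "b = int m' - int n'"
    by (metis int_diff_cases)
  have "a + b = int (m + m') - int (n + n')"
    by (simp add: ab)
  then have "int_power x (a + b) = x ^ (m + m') * y ^ (n + n')"
    by (simp only: diff)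
  also have "\<dots> = (x ^ m * y ^ n) * (x ^ m' * y ^ n')"
    by (simp only: power_add mult_ac)
  finally show ?thesis
    by (simp only: ab diff)
qed

lemma \<Delta>_gen_0: "\<Delta>_gen i j 0 = 1"
proof -
  have "{(s, t). s \<le> i \<and> t \<le> j \<and> s + t = (0::nat)} = {(0, 0)}" by auto
  then show ?thesis by (simp add: \<Delta>_gen_def \<alpha>_def tensor_one_one)
qed

lemma \<Delta>_gen_top: "\<Delta>_gen i j (i + j) = tensor (\<alpha> i ^ (2 ^ j)) (\<alpha> j)"
proof -
  have "{(s, t). s \<le> i \<and> t \<le> j \<and> s + t = i + j} = {(i, j)}" by auto
  then show ?thesis by (simp add: \<Delta>_gen_def)
qed

lemma \<Delta>_gen_top_unit: "\<Delta>_gen i j (i + j) dvd 1"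
proof -
  obtain a where a: "\<alpha> i ^ (2 ^ j) = basis a"
    by (cases "i = 0") (auto simp: \<alpha>_def basis_power simp flip: single_one)
  obtain b where b: "\<alpha> j = basis b"
    by (cases "j = 0") (auto simp: \<alpha>_def simp flip: single_one)
  have "basis (a, b) * basis (- a, - b) = (1 :: mon \<times> mon \<Rightarrow>\<^sub>0 bit)"
    by (simp add: mult_single flip: zero_prod_def)
  then show ?thesis
    unfolding \<Delta>_gen_top a b tensor_basis by (metis dvd_triv_left)
qed

lemma scale_conv_mult:
  "scale c p = Poly_Mapping.single 0 c * (p :: 'a::comm_monoid_add \<Rightarrow>\<^sub>0 'k::field)"
  by (simp add: scale_def mult_map_scale_conv_mult)

lemma lin_ext_mult:
  fixes f :: "'a::comm_monoid_add \<Rightarrow> ('b::comm_monoid_add \<Rightarrow>\<^sub>0 'k::field)"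
  assumes "p \<in> free_on M" "q \<in> free_on M"
    and f: "\<And>a b. a \<in> M \<Longrightarrow> b \<in> M \<Longrightarrow> f (a + b) = f a * f b"
  shows "lin_ext f (p * q) = lin_ext f p * lin_ext f q"
proof -
  interpret Vector_Spaces.linear scale scale "lin_ext f" by (rule linear_lin_ext)
  have expand: "r = (\<Sum>a\<in>keys r. Poly_Mapping.single a (lookup r a))" for r :: "'a \<Rightarrow>\<^sub>0 'k"
    by (rule poly_mapping_eqI)
      (simp add: lookup_sum lookup_single when_def sum.delta in_keys_iff)
  have single: "lin_ext f (Poly_Mapping.single a c) = scale c (f a)" for a c
    by (cases "c = 0") (simp_all add: lin_ext_def)
  have "p * q = (\<Sum>a\<in>keys p. \<Sum>b\<in>keys q.
      Poly_Mapping.single (a + b) (lookup p a * lookup q b))"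
    by (subst (1) expand[of p], subst (1) expand[of q]) (simp add: sum_product mult_single)
  then have "lin_ext f (p * q)
      = (\<Sum>a\<in>keys p. \<Sum>b\<in>keys q. scale (lookup p a * lookup q b) (f (a + b)))"
    by (simp add: sum single)
  also have "\<dots> = (\<Sum>a\<in>keys p. \<Sum>b\<in>keys q. scale (lookup p a) (f a) * scale (lookup q b) (f b))"
  proof (intro sum.cong refl)
    fix a b assume "a \<in> keys p" "b \<in> keys q"
    then have "f (a + b) = f a * f b"
      using assms by (auto simp: free_on_def)
    moreover have "Poly_Mapping.single 0 (lookup p a * lookup q b)
        = Poly_Mapping.single (0 :: 'b) (lookup p a) * Poly_Mapping.single 0 (lookup q b)"
      by (simp add: mult_single)
    ultimately show "scale (lookup p a * lookup q b) (f (a + b))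
        = scale (lookup p a) (f a) * scale (lookup q b) (f b)"
      by (simp only: scale_conv_mult mult_ac)
  qed
  also have "\<dots> = lin_ext f p * lin_ext f q"
    by (simp add: lin_ext_def sum_product)
  finally show ?thesis .
qed

lemma \<Delta>_mult:
  assumes "p \<in> \<B> (i + j)" "q \<in> \<B> (i + j)"
  shows "\<Delta> i j (p * q) = \<Delta> i j p * \<Delta> i j q"
proof -
  let ?M = "{m :: mon. keys m \<subseteq> {1..i + j} \<and> (\<forall>k\<in>{1..<i + j}. lookup m k \<ge> 0)}"
  let ?f = "\<lambda>m :: mon. \<Prod>k\<in>keys m. int_power (\<Delta>_gen i j k) (lookup m k)"
  have f: "?f m = (\<Prod>k\<in>{1..i + j}. int_power (\<Delta>_gen i j k) (lookup m k))"
    if "keys m \<subseteq> {1..i + j}" for m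
    using that by (intro prod.mono_neutral_left) (auto simp: in_keys_iff int_power_def)
  have "?f (m + m') = ?f m * ?f m'" if m: "m \<in> ?M" "m' \<in> ?M" for m m'
  proof -
    have "int_power (\<Delta>_gen i j k) (lookup (m + m') k)
        = int_power (\<Delta>_gen i j k) (lookup m k) * int_power (\<Delta>_gen i j k) (lookup m' k)"
      if "k \<in> {1..i + j}" for k
      unfolding lookup_add
      using m that \<Delta>_gen_top_unit[of i j] by (cases "k = i + j") (auto intro!: int_power_add)
    moreover have "keys (m + m') \<subseteq> {1..i + j}"
      using m Poly_Mapping.keys_add[of m m'] by blast
    ultimately show ?thesis
      using m by (simp add: f prod.distrib)
  qed
  then show ?thesis
    using assms unfolding \<Delta>_def \<B>_def by (intro lin_ext_mult[where M = ?M]) auto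
qed

lemma \<Delta>_one: "\<Delta> i j 1 = 1"
  by (simp add: \<Delta>_def lin_ext_def)

lemma \<Delta>_\<alpha>: "\<Delta> i j (\<alpha> k) = \<Delta>_gen i j k"
proof (cases "k = 0")
  case True
  then show ?thesis by (simp add: \<Delta>_one \<Delta>_gen_0 \<alpha>_def)
next
  case False
  then show ?thesis by (simp add: \<Delta>_def \<alpha>_def int_power_def)
qed

lemma \<Delta>_1_1_\<alpha>_1: "\<Delta> 1 1 (\<alpha> 1) = tensor (\<alpha> 1) 1 + tensor 1 (\<alpha> 1)"
proof -
  have "{(s, t). s \<le> 1 \<and> t \<le> 1 \<and> s + t = (1::nat)} = {(1, 0), (0, 1)}" by auto
  then have "\<Delta>_gen 1 1 1 = tensor (\<alpha> 1) 1 + tensor 1 (\<alpha> 1)"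
    by (simp add: \<Delta>_gen_def \<alpha>_def)
  then show ?thesis
    by (simp only: \<Delta>_\<alpha>)
qed

lemma \<Delta>_1_1_\<alpha>_2: "\<Delta> 1 1 (\<alpha> 2) = tensor (\<alpha> 1) 1 ^ 2 * tensor 1 (\<alpha> 1)"
proof -
  have "\<Delta> 1 1 (\<alpha> 2) = \<Delta>_gen 1 1 (1 + 1)"
    by (simp only: \<Delta>_\<alpha> one_add_one)
  also have "\<dots> = tensor (\<alpha> 1 ^ 2) (\<alpha> 1)"
    by (simp only: \<Delta>_gen_top power_one_right)
  also have "\<dots> = tensor (\<alpha> 1) 1 ^ 2 * tensor 1 (\<alpha> 1)"
    by (simp add: \<alpha>_def power2_eq_square mult_single tensor_basis flip: single_one)
  finally show ?thesis .
qed

text \<open>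
  The underlying graded coalgebra of \<open>\<B>\<close>, in its presentation \<open>\<langle>\<B>\<^sub>1; \<Delta>\<^sub>1\<^sub>,\<^sub>1(\<B>\<^sub>2)\<rangle>\<close> as a
  quadratic coalgebra; \<open>\<B>\<^sub>n\<close> is identified with the degree \<open>n\<close> component by the iterated
  coproduct \<open>\<B>\<^sub>n \<rightarrow> \<B>\<^sub>1\<^bsup>\<otimes>n\<^esup>\<close>.
\<close>

definition \<B>_coalgebra :: "nat \<Rightarrow> (mon list \<Rightarrow>\<^sub>0 bit) set" where
  "\<B>_coalgebra = quadratic_coalgebra (\<B> 1) (\<Delta> 1 1 ` \<B> 2)"

end

theory Submission
  imports Defs
begin

text \<open>
  Write \<open>x\<^sup>i y\<^sup>j\<close> for \<open>\<alpha>\<^sub>1\<^sup>i \<otimes> \<alpha>\<^sub>1\<^sup>j\<close>. For \<open>(i, j) \<in> \<S>\<close>, put \<open>a = i - 2 j \<ge> 0\<close>; then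
  \<open>\<Delta>\<^sub>1\<^sub>,\<^sub>1 (\<alpha>\<^sub>1\<^sup>a \<alpha>\<^sub>2\<^sup>j) = (x + y)\<^sup>a x\<^bsup>2j\<^esup> y\<^sup>j = \<Sum>\<^sub>k (a choose k) x\<^bsup>i-k\<^esup> y\<^bsup>j+k\<^esup>\<close>.
  The leading term \<open>k = 0\<close> is \<open>x\<^sup>i y\<^sup>j\<close>, and passing from \<open>k\<close> to \<open>k + 1\<close> lowers the value of
  \<open>i - 2 j\<close> by \<open>3\<close>. As \<open>(i, j)\<close> runs through \<open>\<S>\<close>, the monomials \<open>\<alpha>\<^sub>1\<^sup>a \<alpha>\<^sub>2\<^sup>j\<close> form a basis of
  \<open>\<B>\<^sub>2\<close>, so the projection to \<open>\<F>\<^sub>2[\<S>]\<close> is unitriangular with respect to a grading by natural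
  numbers, hence bijective.
\<close>

section \<open>Linear maps between free spaces\<close>

interpretation lin_ext: Vector_Spaces.linear scale scale "lin_ext f" for f
  by (rule linear_lin_ext)

lemma lin_ext_cong: "(\<And>a. a \<in> keys p \<Longrightarrow> f a = g a) \<Longrightarrow> lin_ext f p = lin_ext g p"
  by (simp add: lin_ext_def)

lemma lin_ext_lin_ext: "lin_ext f (lin_ext g p) = lin_ext (\<lambda>a. lin_ext f (g a)) p"
  unfolding lin_ext_def[of g] lin_ext_def[of "\<lambda>a. lin_ext f (g a)"]
  by (simp add: lin_ext.sum lin_ext.scale)

lemma lin_ext_basis_id: "lin_ext basis p = p"
  by (rule poly_mapping_eqI)
    (simp add: lookup_lin_ext lookup_single when_def in_keys_iff if_distrib cong: if_cong)

lemma subspace_free_on: "free.subspace (free_on A)"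
proof (rule free.subspaceI)
  show "p + q \<in> free_on A" if "p \<in> free_on A" "q \<in> free_on A" for p q :: "'b \<Rightarrow>\<^sub>0 'a"
    using that Poly_Mapping.keys_add[of p q] by (auto simp: free_on_def)
  show "scale c p \<in> free_on A" if "p \<in> free_on A" for c and p :: "'b \<Rightarrow>\<^sub>0 'a"
    using that by (auto simp: free_on_def in_keys_iff subset_iff)
qed (simp add: free_on_def)

lemma basis_in_free_on: "basis a \<in> free_on A \<longleftrightarrow> a \<in> A"
  by (simp add: free_on_def)

lemma lin_ext_in_subspace:
  assumes "free.subspace W" "p \<in> free_on A" "\<And>a. a \<in> A \<Longrightarrow> f a \<in> W"
  shows "lin_ext f p \<in> W"
  unfolding lin_ext_def using assms
  by (intro free.subspace_sum free.subspace_scale) (auto simp: free_on_def)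

lemma lin_ext_eq_self:
  assumes "p \<in> free_on A" "\<And>a. a \<in> A \<Longrightarrow> f a = basis a"
  shows "lin_ext f p = p"
  using lin_ext_cong[of p f basis] assms by (auto simp: lin_ext_basis_id free_on_def)

text \<open>Relabelling basis elements injectively is undone by the inverse relabelling.\<close>

lemma bij_betw_lin_ext_basis:
  fixes g :: "'a \<Rightarrow> 'b"
  assumes "inj_on g A"
  shows "bij_betw (lin_ext (\<lambda>a. basis (g a)) :: ('a \<Rightarrow>\<^sub>0 'k::field) \<Rightarrow> _) (free_on A) (free_on (g ` A))"
proof (rule bij_betw_byWitness[where f' = "lin_ext (\<lambda>b. basis (inv_into A g b))"])
  show "\<forall>p\<in>free_on A. lin_ext (\<lambda>b. basis (inv_into A g b)) (lin_ext (\<lambda>a. basis (g a)) p) = p"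
    using assms by (auto simp: lin_ext_lin_ext intro!: lin_ext_eq_self[of _ A])
  show "\<forall>q\<in>free_on (g ` A). lin_ext (\<lambda>a. basis (g a)) (lin_ext (\<lambda>b. basis (inv_into A g b)) q) = q"
    by (auto simp: lin_ext_lin_ext f_inv_into_f intro!: lin_ext_eq_self[of _ "g ` A"])
qed (auto intro!: lin_ext_in_subspace subspace_free_on simp: basis_in_free_on inv_into_into)

text \<open>As \<open>A\<close> may be infinite, injectivity and surjectivity are argued separately.
  In the support of \<open>p\<close>, an index of maximal \<open>\<mu>\<close> keeps its coefficient
  in the image, so the kernel is trivial. Basis elements are reached by induction on
  \<open>\<mu>\<close>.\<close>

lemma bij_betw_lin_ext_unitriangular:
  fixes f :: "'a \<Rightarrow> ('a \<Rightarrow>\<^sub>0 'k::field)" and \<mu> :: "'a \<Rightarrow> nat"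
  assumes f: "\<And>a. a \<in> A \<Longrightarrow> f a - basis a \<in> free_on {b \<in> A. \<mu> b < \<mu> a}"
  shows "bij_betw (lin_ext f) (free_on A) (free_on A)"
proof (rule bij_betw_imageI)
  have "p = 0" if p: "p \<in> free_on A" "lin_ext f p = 0" for p
  proof (rule ccontr)
    assume "p \<noteq> 0"
    then have "Max (\<mu> ` keys p) \<in> \<mu> ` keys p"
      by (intro Max_in) auto
    then obtain a where a: "a \<in> keys p" and "\<mu> a = Max (\<mu> ` keys p)"
      by auto
    then have max: "\<mu> b \<le> \<mu> a" if "b \<in> keys p" for b
      using that by simp
    have "lookup (f b) a = (1 when b = a)" if b: "b \<in> keys p" for b
    proof -
      have "b \<in> A"
        using b p(1) by (auto simp: free_on_def)
      \<comment> \<open>The support of \<open>f b - basis b\<close> lies strictly below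
        \<open>\<mu> b \<le> \<mu> a\<close>, so it misses \<open>a\<close>.\<close>
      then have "a \<notin> keys (f b - basis b)"
        using f[of b] max[OF b] by (auto simp: free_on_def subset_iff not_less)
      then show ?thesis
        by (simp add: in_keys_iff lookup_minus lookup_single)
    qed
    then have "lookup (lin_ext f p) a = (\<Sum>b\<in>keys p. if b = a then lookup p a else 0)"
      unfolding lookup_lin_ext by (intro sum.cong) (auto simp: when_def)
    with a p(2) show False
      by (simp add: in_keys_iff)
  qed
  then show "inj_on (lin_ext f) (free_on A)"
    unfolding inj_on_def
    by (metis lin_ext.diff right_minus_eq subspace_free_on free.subspace_diff)
next
  have sub: "free.subspace (lin_ext f ` free_on A)"
    by (rule lin_ext.subspace_image[OF subspace_free_on])
  have "basis a \<in> lin_ext f ` free_on A" if "a \<in> A" for a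
    using that
  proof (induction "\<mu> a" arbitrary: a rule: less_induct)
    case less
    let ?r = "f a - basis a"
    \<comment> \<open>\<open>lin_ext basis\<close> is the identity; written this way, membership
      reduces to basis elements of smaller \<open>\<mu>\<close>, which the induction hypothesis
      covers.\<close>
    have "lin_ext basis ?r \<in> lin_ext f ` free_on A"
      using f[OF less.prems] less.hyps by (intro lin_ext_in_subspace[OF sub]) auto
    moreover have "f a \<in> lin_ext f ` free_on A"
      using less.prems by (intro image_eqI[of _ _ "basis a"]) (auto simp: basis_in_free_on)
    ultimately have "f a - ?r \<in> lin_ext f ` free_on A"
      unfolding lin_ext_basis_id using free.subspace_diff[OF sub] by blast
    then show ?case
      by simp
  qed
  then have "lin_ext basis p \<in> lin_ext f ` free_on A" if "p \<in> free_on A" for p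
    using that by (intro lin_ext_in_subspace[OF sub])
  moreover have "f a \<in> free_on A" if "a \<in> A" for a
  proof -
    have "f a - basis a + basis a \<in> free_on A"
      using f[OF that] that
      by (intro free.subspace_add[OF subspace_free_on]) (auto simp: free_on_def)
    then show ?thesis by simp
  qed
  ultimately show "lin_ext f ` free_on A = free_on A"
    by (auto simp: lin_ext_basis_id intro: lin_ext_in_subspace[OF subspace_free_on])
qed


section \<open>The coproduct in bidegree \<open>(1, 1)\<close>\<close>

definition xy_mon :: "int \<Rightarrow> int \<Rightarrow> (mon \<times> mon \<Rightarrow>\<^sub>0 bit)" where
  "xy_mon i j = basis (Poly_Mapping.single 1 i, Poly_Mapping.single 1 j)"

lemma xy_mon_mult: "xy_mon i j * xy_mon k l = xy_mon (i + k) (j + l)"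
  by (simp add: xy_mon_def mult_single single_add)

lemma xy_mon_zero: "xy_mon 0 0 = 1"
  by (simp add: xy_mon_def flip: zero_prod_def)

lemma xy_mon_power: "xy_mon i j ^ n = xy_mon (int n * i) (int n * j)"
  by (induction n) (simp_all add: xy_mon_zero xy_mon_mult algebra_simps)

lemma int_power_xy_mon: "int_power (xy_mon i j) n = xy_mon (n * i) (n * j)"
proof -
  have "xy_mon i j * xy_mon (- i) (- j) = 1"
    by (simp add: xy_mon_mult xy_mon_zero)
  then show ?thesis
    by (simp add: int_power_unit xy_mon_power)
qed

text \<open>Shows that the given isomorphism onto \<open>\<B> 1\<close> merely relabels basis
  elements; the explicit inverse of \<open>\<alpha> 1\<close> handles negative
  \<open>n\<close>.\<close>

lemma int_power_\<alpha>_1: "int_power (\<alpha> 1) n = basis (Poly_Mapping.single 1 n)"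
proof -
  have power: "(basis (Poly_Mapping.single 1 i) :: laurent) ^ k = basis (Poly_Mapping.single 1 (int k * i))"
    for i k
    by (induction k) (simp_all add: mult_single algebra_simps flip: single_add)
  have unit: "\<alpha> 1 * basis (Poly_Mapping.single 1 (- 1)) = 1"
    by (simp add: \<alpha>_def mult_single flip: single_add)
  show ?thesis
    unfolding int_power_unit[OF unit] by (auto simp: \<alpha>_def power simp del: One_nat_def)
qed

text \<open>The summand y comes first so that \<open>k\<close> in the binomial theorem counts powers
  of y.\<close>

lemma \<Delta>_gen_1_1_1: "\<Delta>_gen 1 1 1 = xy_mon 0 1 + xy_mon 1 0"
proof -
  have "\<Delta>_gen 1 1 1 = tensor (\<alpha> 1) 1 + tensor 1 (\<alpha> 1)"
    by (simp only: \<Delta>_1_1_\<alpha>_1 flip: \<Delta>_\<alpha>)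
  then show ?thesis
    by (simp add: \<alpha>_def xy_mon_def tensor_basis flip: single_one)
qed

lemma \<Delta>_gen_1_1_2: "\<Delta>_gen 1 1 2 = xy_mon 2 1"
proof -
  have "\<Delta>_gen 1 1 2 = tensor (\<alpha> 1) 1 ^ 2 * tensor 1 (\<alpha> 1)"
    by (simp only: \<Delta>_1_1_\<alpha>_2 flip: \<Delta>_\<alpha>)
  also have "\<dots> = xy_mon 1 0 ^ 2 * xy_mon 0 1"
    by (simp add: \<alpha>_def xy_mon_def tensor_basis flip: single_one)
  finally show ?thesis
    by (simp add: xy_mon_power xy_mon_mult)
qed

text \<open>The monomial is indexed by the exponents of the leading term of its coproduct, so that
  source and target of the triangular map share one index set.\<close>

definition \<B>2_mon :: "int \<times> int \<Rightarrow> mon" where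
  "\<B>2_mon = (\<lambda>(i, j). Poly_Mapping.single 1 (i - 2 * j) + Poly_Mapping.single 2 j)"

text \<open>For \<open>i \<ge> 2 * j\<close>, the coordinates of that coproduct before the
  identification with the tensor square of \<open>\<B> 1\<close>.\<close>

definition \<Delta>_expansion :: "int \<times> int \<Rightarrow> (int \<times> int \<Rightarrow>\<^sub>0 bit)" where
  "\<Delta>_expansion = (\<lambda>(i, j). \<Sum>k\<le>nat (i - 2 * j).
     scale (of_nat (nat (i - 2 * j) choose k)) (basis (i - int k, j + int k)))"

lemma \<Delta>_1_1_\<B>2_mon:
  assumes "i \<ge> 2 * j"
  shows "\<Delta> 1 1 (basis (\<B>2_mon (i, j))) = lin_ext (\<lambda>(i, j). xy_mon i j) (\<Delta>_expansion (i, j))"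
proof -
  let ?m = "\<B>2_mon (i, j)" and ?n = "nat (i - 2 * j)"
  have lookup: "lookup ?m 1 = i - 2 * j" "lookup ?m 2 = j"
    by (simp_all add: \<B>2_mon_def lookup_add lookup_single)
  have keys: "keys ?m \<subseteq> {1, 2}"
    by (auto simp: \<B>2_mon_def in_keys_iff lookup_add lookup_single when_def split: if_splits)
  have "\<Delta> 1 1 (basis ?m) = (\<Prod>k\<in>keys ?m. int_power (\<Delta>_gen 1 1 k) (lookup ?m k))"
    by (simp add: \<Delta>_def)
  also have "\<dots> = (\<Prod>k\<in>{1, 2}. int_power (\<Delta>_gen 1 1 k) (lookup ?m k))"
    using keys by (intro prod.mono_neutral_left) (auto simp: in_keys_iff int_power_def)
  also have "\<dots> = int_power (\<Delta>_gen 1 1 1) (i - 2 * j) * int_power (\<Delta>_gen 1 1 2) j"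
    using lookup by simp
  \<comment> \<open>x + y is not a unit; the hypothesis makes its exponent a natural number, so the
    binomial theorem applies.\<close>
  also have "\<dots> = (xy_mon 0 1 + xy_mon 1 0) ^ ?n * xy_mon (2 * j) j"
    using assms unfolding \<Delta>_gen_1_1_1 \<Delta>_gen_1_1_2 int_power_xy_mon
    by (simp add: int_power_def mult.commute)
  also have "\<dots> = (\<Sum>k\<le>?n. scale (of_nat (?n choose k)) (xy_mon (i - int k) (j + int k)))"
    unfolding binomial_ring sum_distrib_right
  proof (intro sum.cong refl)
    fix k assume "k \<in> {..?n}"
    \<comment> \<open>The exponent of x; \<open>k \<le> ?n\<close> keeps the truncated subtraction
      exact.\<close>
    then have "int (?n - k) + 2 * j = i - int k"
      using assms by auto
    then show "of_nat (?n choose k) * xy_mon 0 1 ^ k * xy_mon 1 0 ^ (?n - k) * xy_mon (2 * j) j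
        = scale (of_nat (?n choose k)) (xy_mon (i - int k) (j + int k))"
      by (simp add: xy_mon_power xy_mon_mult mult.assoc scale_conv_mult add.commute)
  qed
  finally show ?thesis
    by (simp add: \<Delta>_expansion_def lin_ext.sum lin_ext.scale)
qed

section \<open>Monomial bases of \<open>\<B> 1\<close> and \<open>\<B> 2\<close>, and the relation
  space\<close>

lemma \<B>_1: "\<B> 1 = free_on (range (Poly_Mapping.single 1))"
proof -
  have "keys m \<subseteq> {1} \<longleftrightarrow> m \<in> range (Poly_Mapping.single 1)" for m :: mon
  proof
    assume "keys m \<subseteq> {1}"
    then have "m = Poly_Mapping.single 1 (lookup m 1)"
      by (intro poly_mapping_eqI) (auto simp: lookup_single when_def in_keys_iff)
    then show "m \<in> range (Poly_Mapping.single 1)" by blast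
  qed (auto split: if_splits)
  \<comment> \<open>The range \<open>{1..<1}\<close> of the sign condition is empty, so all integer
    exponents occur.\<close>
  then show ?thesis
    by (simp add: \<B>_def)
qed

lemma \<B>_2: "\<B> 2 = free_on (\<B>2_mon ` {(i, j). i \<ge> 2 * j})"
proof -
  have "keys m \<subseteq> {1..2} \<and> (\<forall>k\<in>{1..<2}. lookup m k \<ge> 0) \<longleftrightarrow> m \<in> \<B>2_mon ` {(i, j). i \<ge> 2 * j}" for m
  proof
    assume m: "keys m \<subseteq> {1..2} \<and> (\<forall>k\<in>{1..<2}. lookup m k \<ge> 0)"
    have "lookup m k = 0" if "k \<noteq> 1" "k \<noteq> 2" for k
    proof -
      have "k \<notin> {1..2}" using that by auto
      then show ?thesis using m by (auto simp: in_keys_iff)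
    qed
    \<comment> \<open>Solves \<open>i - 2 * j = lookup m 1\<close> and
      \<open>j = lookup m 2\<close>; the sign condition on \<open>lookup m 1\<close> becomes
      \<open>i \<ge> 2 * j\<close>.\<close>
    then have "m = \<B>2_mon (lookup m 1 + 2 * lookup m 2, lookup m 2)"
      by (intro poly_mapping_eqI) (auto simp: \<B>2_mon_def lookup_add lookup_single when_def)
    then show "m \<in> \<B>2_mon ` {(i, j). i \<ge> 2 * j}"
      using m by (intro image_eqI) auto
  qed (auto simp: \<B>2_mon_def lookup_add lookup_single when_def in_keys_iff split: if_splits)
  then show ?thesis
    by (simp add: \<B>_def)
qed

lemma inj_\<B>2_mon: "inj \<B>2_mon"
proof (rule injI)
  fix s t assume "\<B>2_mon s = \<B>2_mon t"
  then have "lookup (\<B>2_mon s) k = lookup (\<B>2_mon t) k" for k by simp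
  from this[of 1] this[of 2] show "s = t"
    by (auto simp: \<B>2_mon_def lookup_add lookup_single split: prod.splits)
qed

text \<open>Exhibits the outer map as a factor of the coproduct, so that its inverse cancels in the
  admissibility composite. The two sides are compared on the monomial basis of
  \<open>\<B> 2\<close>.\<close>

lemma \<Delta>_1_1_image_\<B>_2:
  "\<Delta> 1 1 ` \<B> 2 = lin_ext (\<lambda>(i, j). xy_mon i j) ` lin_ext \<Delta>_expansion ` free_on {(i, j). i \<ge> 2 * j}"
proof -
  let ?S = "{(i :: int, j). i \<ge> 2 * j}"
  have "\<B> 2 = lin_ext (\<lambda>s. basis (\<B>2_mon s)) ` free_on ?S"
    unfolding \<B>_2
    by (intro bij_betw_imp_surj_on[symmetric] bij_betw_lin_ext_basis
        inj_on_subset[OF inj_\<B>2_mon subset_UNIV])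
  moreover have "\<Delta> 1 1 (lin_ext (\<lambda>s. basis (\<B>2_mon s)) p)
      = lin_ext (\<lambda>(i, j). xy_mon i j) (lin_ext \<Delta>_expansion p)" if "p \<in> free_on ?S" for p
  proof -
    have "\<Delta> 1 1 (lin_ext (\<lambda>s. basis (\<B>2_mon s)) p) = lin_ext (\<lambda>s. \<Delta> 1 1 (basis (\<B>2_mon s))) p"
      unfolding \<Delta>_def by (rule lin_ext_lin_ext)
    also have "\<dots> = lin_ext (\<lambda>s. lin_ext (\<lambda>(i, j). xy_mon i j) (\<Delta>_expansion s)) p"
    proof (rule lin_ext_cong)
      fix s assume "s \<in> keys p"
      then show "\<Delta> 1 1 (basis (\<B>2_mon s)) = lin_ext (\<lambda>(i, j). xy_mon i j) (\<Delta>_expansion s)"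
        using that \<Delta>_1_1_\<B>2_mon by (cases s) (auto simp: free_on_def simp del: One_nat_def)
    qed
    finally show ?thesis
      by (simp only: lin_ext_lin_ext)
  qed
  ultimately show ?thesis
    by (simp add: image_image)
qed

lemma bij_betw_proj_on_\<Delta>_expansion:
  defines "S \<equiv> {(i :: int, j). i \<ge> 2 * j}"
  shows "bij_betw (proj_on S \<circ> lin_ext \<Delta>_expansion) (free_on S) (free_on S)"
proof -
  \<comment> \<open>On \<open>S\<close> the difference is nonnegative, so \<open>nat\<close> loses
    nothing.\<close>
  let ?\<mu> = "\<lambda>(i, j). nat (i - 2 * j)"
  have "proj_on S (\<Delta>_expansion s) - basis s \<in> free_on {t \<in> S. ?\<mu> t < ?\<mu> s}" if "s \<in> S" for s
  proof -
    obtain i j where s: "s = (i, j)" and ij: "i \<ge> 2 * j"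
      using \<open>s \<in> S\<close> by (auto simp: S_def)
    let ?n = "nat (i - 2 * j)"
    let ?g = "\<lambda>k. scale (of_nat (?n choose k))
      (if (i - int k, j + int k) \<in> S then basis (i - int k, j + int k) else (0 :: _ \<Rightarrow>\<^sub>0 bit))"
    have "proj_on S (\<Delta>_expansion s) = sum ?g {..?n}"
      by (simp add: s proj_on_def \<Delta>_expansion_def lin_ext.sum lin_ext.scale)
    also have "\<dots> = ?g 0 + sum ?g {1..?n}"
      by (simp add: atMost_atLeast0 sum.atLeast_Suc_atMost)
    also have "?g 0 = basis s"
      using \<open>s \<in> S\<close> by (simp add: s)
    finally have "proj_on S (\<Delta>_expansion s) - basis s = sum ?g {1..?n}"
      by simp
    moreover have "?g k \<in> free_on {t \<in> S. ?\<mu> t < ?\<mu> s}" if "k \<in> {1..?n}" for k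
      \<comment> \<open>The pair at \<open>k\<close> has difference
        \<open>i - 2 * j - 3 * k\<close>: for \<open>k \<ge> 1\<close> it is smaller if the pair
        stays in \<open>S\<close>, and otherwise the term is projected to 0.\<close>
      using that ij
      by (intro free.subspace_scale[OF subspace_free_on])
        (auto simp: basis_in_free_on s S_def free.subspace_0[OF subspace_free_on])
    ultimately show ?thesis
      by (metis (no_types, lifting) free.subspace_sum subspace_free_on)
  qed
  then have "bij_betw (lin_ext (\<lambda>s. proj_on S (\<Delta>_expansion s))) (free_on S) (free_on S)"
    by (rule bij_betw_lin_ext_unitriangular)
  then show ?thesis
    by (simp add: proj_on_def lin_ext_lin_ext comp_def)
qed

section \<open>Bijectivity of the composite from the relation space to the free space on the index
  set\<close>

theorem proposition5p1p5:
  shows "admissible {(i :: int, j :: int). i \<ge> 2 * j} \<B>_coalgebra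
           (lin_ext (\<lambda>n. int_power (\<alpha> 1) n))"
proof -
  let ?S = "{(i :: int, j). i \<ge> 2 * j}"
  let ?\<phi> = "lin_ext (\<lambda>n. int_power (\<alpha> 1) n)"
  define \<psi> where "\<psi> = lin_ext (\<lambda>(i, j). xy_mon i j)"
  have \<psi>: "tensor_square_map ?\<phi> = \<psi>"
    by (simp add: tensor_square_map_def \<psi>_def xy_mon_def int_power_\<alpha>_1 tensor_basis
        del: One_nat_def)
  have UNIV: "free_on UNIV = UNIV"
    by (simp add: free_on_def)
  \<comment> \<open>\<open>\<psi>\<close> sends basis elements to distinct basis elements, so it is
    injective and \<open>inv\<close> undoes it on its image.\<close>
  have "inj (\<lambda>(i, j). (Poly_Mapping.single 1 i :: mon, Poly_Mapping.single 1 j :: mon))"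
    by (auto intro!: injI dest: inj_onD[OF inj_single])
  from bij_betw_imp_inj_on[OF bij_betw_lin_ext_basis[OF this]] have "inj \<psi>"
    unfolding \<psi>_def xy_mon_def UNIV case_prod_unfold .
  have R: "\<Delta> 1 1 ` \<B> 2 = \<psi> ` lin_ext \<Delta>_expansion ` free_on ?S"
    unfolding \<psi>_def by (rule \<Delta>_1_1_image_\<B>_2)
  show ?thesis
    unfolding admissible_def
  \<comment> \<open>The witnesses are the two spaces that define
    \<open>\<B>_coalgebra\<close>.\<close>
  proof (intro exI conjI)
    show "free.subspace (\<B> 1)"
      unfolding \<B>_1 by (rule subspace_free_on)
    show "free.subspace (\<Delta> 1 1 ` \<B> 2)"
      unfolding R \<psi>_def by (intro lin_ext.subspace_image subspace_free_on)
    have "\<psi> p \<in> tensor_space (\<B> 1) (\<B> 1)" for p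
      unfolding \<psi>_def
    proof (rule lin_ext_in_subspace[where A = UNIV])
      show "free.subspace (tensor_space (\<B> 1) (\<B> 1))"
        unfolding tensor_space_def by (rule free.subspace_span)
      show "(case s of (i, j) \<Rightarrow> xy_mon i j) \<in> tensor_space (\<B> 1) (\<B> 1)" for s
        unfolding tensor_space_def \<B>_1 xy_mon_def
        by (cases s) (auto intro!: free.span_base exI simp: basis_in_free_on simp flip: tensor_basis)
    qed (simp add: UNIV)
    then show "\<Delta> 1 1 ` \<B> 2 \<subseteq> tensor_space (\<B> 1) (\<B> 1)"
      unfolding R by blast
    show "\<B>_coalgebra = quadratic_coalgebra (\<B> 1) (\<Delta> 1 1 ` \<B> 2)"
      by (rule \<B>_coalgebra_def)
    show "Vector_Spaces.linear scale scale ?\<phi>"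
      by (rule linear_lin_ext)
    show "bij_betw ?\<phi> UNIV (\<B> 1)"
      unfolding \<B>_1 int_power_\<alpha>_1
      using bij_betw_lin_ext_basis[OF inj_single] by (simp add: UNIV)
    have "bij_betw (inv \<psi>) (\<psi> ` lin_ext \<Delta>_expansion ` free_on ?S) (lin_ext \<Delta>_expansion ` free_on ?S)"
      using \<open>inj \<psi>\<close> by (intro bij_betw_imageI) (auto simp: inj_on_def image_image)
    \<comment> \<open>If a composite is bijective, its outer map is bijective on the image of the
      inner one.\<close>
    moreover have "bij_betw (proj_on ?S) (lin_ext \<Delta>_expansion ` free_on ?S) (free_on ?S)"
      using bij_betw_proj_on_\<Delta>_expansion
      by (auto simp: bij_betw_def image_comp dest: inj_on_imageI)
    ultimately show "bij_betw (proj_on ?S \<circ> inv (tensor_square_map ?\<phi>)) (\<Delta> 1 1 ` \<B> 2) (free_on ?S)"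
      unfolding R \<psi> by (rule bij_betw_trans)
  qed
qed

end
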